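(* Let $(P;\oplus,0,1)$ be a pseudo-effect algebra with its induced partial order $\le$ and complements ${}^-,{}^{\sim}$. Define partial operations on $P$ by $x\circ y:=y^-/ x$ for $y^-\le x$; $\;x\ast y:=x\backslash y^{\sim}$ for $y^{\sim}\le x$; $\;x\rightarrow y:=(x\circ y^{\sim})^-$ and $x\leadsto y:=(x\ast y^-)^{\sim}$, both for $y\le x$. Then $(P;\circ,\ast,\rightarrow,\leadsto,0,1)$ is a conditional double CI-poset satisfying the pseudoinvolution, divisibility, associativity and pseudo-effect algebra conditions.
   Context: A pseudo-effect algebra (PEA) is a partial algebra $(P;\oplus,0,1)$, with $\oplus$ a partial binary operation and $0,1$ constants, such that for all $a,b,c\in P$: (PE1) $a\oplus b$ and $(a\oplus b)\oplus c$ exist iff $b\oplus c$ and $a\oplus(b\oplus c)$ exist, and in this case $(a\oplus b)\oplus c=a\oplus(b\oplus c)$; (PE2) there exist exactly one $d\in P$ and exactly one $e\in P$ with $a\oplus d=e\oplus a=1$; (PE3) if $a\oplus b$ exists, there are $d,e\in P$ with $a\oplus b=d\oplus a=b\oplus e$; (PE4) if $a\oplus 1$ or $1\oplus a$ exists, then $a=0$. The partial order is: $a\le b$ iff $c\oplus a=b$ for some $c\in P$, equivalently iff $a\oplus d=b$ for some $d\in P$. For $a\le b$, $b\backslash a$ is the element $x$ with $b=x\oplus a$, and $a/ b$ is the element $y$ with $b=a\oplus y$ (these are unique). Complements: $a^-:=1\backslash a$ and $a^{\sim}:=a/ 1$, so $a^-\oplus a=1=a\oplus a^{\sim}$. The sum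 $a\oplus b$ exists iff $a\le b^-$, equivalently iff $b\le a^{\sim}$. A conditional double CI-poset is a system $(R;\circ,\ast,\rightarrow,\leadsto,0,1)$ on a bounded poset $(R;\le,0,1)$ (least element $0$, greatest element $1$), with partial binary operations $\circ,\ast,\rightarrow,\leadsto$, such that for all $x,y,z\in R$: (a) $x\rightarrow y$ is defined iff $y\le x$; $x\leadsto y$ is defined iff $y\le x$; $x\circ y$ is defined iff $y\rightarrow 0\le x$; $x\ast y$ is defined iff $y\leadsto 0\le x$; (b) $x\circ 1=1\circ x=x\ast 1=1\ast x=x$; (c) if $x\circ y$ and $x\leadsto z$ are defined, then $x\circ y\le z$ iff $y\le x\leadsto z$; if $x\ast y$ and $x\rightarrow z$ are defined, then $x\ast y\le z$ iff $y\le x\rightarrow z$. Additional conditions, for all $x,y,z\in R$, where in such a system $x^-:=x\rightarrow 0$ and $x^{\sim}:=x\leadsto 0$: - (pseudoinvolution) $x\le y$ implies $y^-\le x^-$ and $y^{\sim}\le x^{\sim}$; and $(x^-)^{\sim}=x=(x^{\sim})^-$; - (divisibility) $x\le y\iff x=y\circ(y\leadsto x)=y\ast(y\rightarrow x)$ (with all these terms defined); - (associativity) $(x\circ y)\circ z=x\circ(y\circ z)$ and $(x\ast y)\ast z=x\ast(y\ast z)$, in the sense that if one side is defined so is the other and equality holds; - (pseudo-effect algebra condition) $(y^-\ast x^-)^{\sim}=(x^{\sim}\circ y^{\sim})^-$ (whenever defined, i.e. whenever $x\le y^-$). *)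

theory Defs
  imports Main
begin

text \<open>
  A partial binary operation on \<open>A\<close> is a function of type
  \<open>'a \<Rightarrow> 'a \<Rightarrow> 'a option\<close> whose graph lies in
  \<open>A \<times> A \<times> A\<close>; \<open>None\<close> means ``undefined''.
  Nested partial terms are written with \<open>Option.bind\<close>, which is strict, so that an
  equation between two such terms says that one side is defined iff the other one is, and that
  the values then agree.
\<close>

definition partial_binop_on :: "'a set \<Rightarrow> ('a \<Rightarrow> 'a \<Rightarrow> 'a option) \<Rightarrow> bool" where
  "partial_binop_on A f \<longleftrightarrow> (\<forall>x y z. f x y = Some z \<longrightarrow> x \<in> A \<and> y \<in> A \<and> z \<in> A)"

locale pseudo_effect_algebra =
  fixes P :: "'a set"
    and oplus :: "'a \<Rightarrow> 'a \<Rightarrow> 'a option"  (infixl "\<oplus>" 65)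
    and zero :: 'a  ("\<zero>")
    and one :: 'a  ("\<one>")
  assumes partial_binop_oplus: "partial_binop_on P (\<oplus>)"
    and zero_closed: "\<zero> \<in> P"
    and one_closed: "\<one> \<in> P"
    and PE1: "\<lbrakk>a \<in> P; b \<in> P; c \<in> P\<rbrakk>
      \<Longrightarrow> Option.bind (a \<oplus> b) (\<lambda>u. u \<oplus> c) = Option.bind (b \<oplus> c) (\<lambda>v. a \<oplus> v)"
    and PE2_right: "a \<in> P \<Longrightarrow> \<exists>!d. d \<in> P \<and> a \<oplus> d = Some \<one>"
    and PE2_left: "a \<in> P \<Longrightarrow> \<exists>!e. e \<in> P \<and> e \<oplus> a = Some \<one>"
    and PE3: "\<lbrakk>a \<in> P; b \<in> P; a \<oplus> b = Some c\<rbrakk>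
      \<Longrightarrow> \<exists>d\<in>P. \<exists>e\<in>P. d \<oplus> a = Some c \<and> b \<oplus> e = Some c"
    and PE4: "\<lbrakk>a \<in> P; a \<oplus> \<one> \<noteq> None \<or> \<one> \<oplus> a \<noteq> None\<rbrakk> \<Longrightarrow> a = \<zero>"
begin

definition le :: "'a \<Rightarrow> 'a \<Rightarrow> bool"  (infix "\<sqsubseteq>" 50) where
  "a \<sqsubseteq> b \<longleftrightarrow> a \<in> P \<and> b \<in> P \<and> (\<exists>c\<in>P. c \<oplus> a = Some b)"

text \<open>
  The differences \<open>ldiff b a\<close> (written \<open>b\a\<close> on paper) and
  \<open>rdiff a b\<close> (written \<open>a/b\<close>) are meaningful only for \<open>a \<sqsubseteq> b\<close>.
\<close>

definition ldiff :: "'a \<Rightarrow> 'a \<Rightarrow> 'a" where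
  "ldiff b a = (THE x. x \<in> P \<and> x \<oplus> a = Some b)"

definition rdiff :: "'a \<Rightarrow> 'a \<Rightarrow> 'a" where
  "rdiff a b = (THE y. y \<in> P \<and> a \<oplus> y = Some b)"

definition lcompl :: "'a \<Rightarrow> 'a"  ("_\<^sup>-" [1000] 1000) where
  "a\<^sup>- = ldiff \<one> a"

definition rcompl :: "'a \<Rightarrow> 'a"  ("_\<^sup>\<sim>" [1000] 1000) where
  "a\<^sup>\<sim> = rdiff a \<one>"

definition circ :: "'a \<Rightarrow> 'a \<Rightarrow> 'a option"  (infixl "\<odot>" 70) where
  "x \<odot> y = (if x \<in> P \<and> y \<in> P \<and> y\<^sup>- \<sqsubseteq> x then Some (rdiff (y\<^sup>-) x) else None)"

definition ast :: "'a \<Rightarrow> 'a \<Rightarrow> 'a option"  (infixl "\<star>" 70) where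
  "x \<star> y = (if x \<in> P \<and> y \<in> P \<and> y\<^sup>\<sim> \<sqsubseteq> x then Some (ldiff x (y\<^sup>\<sim>)) else None)"

definition imp :: "'a \<Rightarrow> 'a \<Rightarrow> 'a option"  (infixr "\<rightarrow>" 60) where
  "x \<rightarrow> y = (if x \<in> P \<and> y \<in> P \<and> y \<sqsubseteq> x then map_option lcompl (x \<odot> y\<^sup>\<sim>) else None)"

definition limp :: "'a \<Rightarrow> 'a \<Rightarrow> 'a option"  (infixr "\<leadsto>" 60) where
  "x \<leadsto> y = (if x \<in> P \<and> y \<in> P \<and> y \<sqsubseteq> x then map_option rcompl (x \<star> y\<^sup>-) else None)"

end

text \<open>
  In the next locale the negations are total functions: by \<open>imp_defined\<close>,
  \<open>limp_defined\<close> and \<open>zero_least\<close> the terms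
  \<open>x \<rightarrow> \<zero>\<close> and \<open>x \<leadsto> \<zero>\<close> are
  defined for every \<open>x \<in> R\<close>.
\<close>

locale conditional_double_CI_poset =
  fixes R :: "'a set"
    and le :: "'a \<Rightarrow> 'a \<Rightarrow> bool"  (infix "\<sqsubseteq>" 50)
    and circ :: "'a \<Rightarrow> 'a \<Rightarrow> 'a option"  (infixl "\<odot>" 70)
    and ast :: "'a \<Rightarrow> 'a \<Rightarrow> 'a option"  (infixl "\<star>" 70)
    and imp :: "'a \<Rightarrow> 'a \<Rightarrow> 'a option"  (infixr "\<rightarrow>" 60)
    and limp :: "'a \<Rightarrow> 'a \<Rightarrow> 'a option"  (infixr "\<leadsto>" 60)
    and zero :: 'a  ("\<zero>")
    and one :: 'a  ("\<one>")
  assumes le_refl: "reflp_on R (\<sqsubseteq>)"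
    and le_antisym: "antisymp_on R (\<sqsubseteq>)"
    and le_trans: "transp_on R (\<sqsubseteq>)"
    and zero_closed: "\<zero> \<in> R"
    and one_closed: "\<one> \<in> R"
    and zero_least: "x \<in> R \<Longrightarrow> \<zero> \<sqsubseteq> x"
    and one_greatest: "x \<in> R \<Longrightarrow> x \<sqsubseteq> \<one>"
    and partial_binop_circ: "partial_binop_on R (\<odot>)"
    and partial_binop_ast: "partial_binop_on R (\<star>)"
    and partial_binop_imp: "partial_binop_on R (\<rightarrow>)"
    and partial_binop_limp: "partial_binop_on R (\<leadsto>)"
    and imp_defined: "\<lbrakk>x \<in> R; y \<in> R\<rbrakk> \<Longrightarrow> x \<rightarrow> y \<noteq> None \<longleftrightarrow> y \<sqsubseteq> x"
    and limp_defined: "\<lbrakk>x \<in> R; y \<in> R\<rbrakk> \<Longrightarrow> x \<leadsto> y \<noteq> None \<longleftrightarrow> y \<sqsubseteq> x"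
    and circ_defined: "\<lbrakk>x \<in> R; y \<in> R\<rbrakk> \<Longrightarrow> x \<odot> y \<noteq> None \<longleftrightarrow> the (y \<rightarrow> \<zero>) \<sqsubseteq> x"
    and ast_defined: "\<lbrakk>x \<in> R; y \<in> R\<rbrakk> \<Longrightarrow> x \<star> y \<noteq> None \<longleftrightarrow> the (y \<leadsto> \<zero>) \<sqsubseteq> x"
    and circ_one_right: "x \<in> R \<Longrightarrow> x \<odot> \<one> = Some x"
    and circ_one_left: "x \<in> R \<Longrightarrow> \<one> \<odot> x = Some x"
    and ast_one_right: "x \<in> R \<Longrightarrow> x \<star> \<one> = Some x"
    and ast_one_left: "x \<in> R \<Longrightarrow> \<one> \<star> x = Some x"
    and circ_adjoint: "\<lbrakk>x \<in> R; y \<in> R; z \<in> R; x \<odot> y = Some u; x \<leadsto> z = Some v\<rbrakk>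
      \<Longrightarrow> u \<sqsubseteq> z \<longleftrightarrow> y \<sqsubseteq> v"
    and ast_adjoint: "\<lbrakk>x \<in> R; y \<in> R; z \<in> R; x \<star> y = Some u; x \<rightarrow> z = Some v\<rbrakk>
      \<Longrightarrow> u \<sqsubseteq> z \<longleftrightarrow> y \<sqsubseteq> v"
begin

definition lneg :: "'a \<Rightarrow> 'a"  ("_\<^sup>-" [1000] 1000) where
  "x\<^sup>- = the (x \<rightarrow> \<zero>)"

definition rneg :: "'a \<Rightarrow> 'a"  ("_\<^sup>\<sim>" [1000] 1000) where
  "x\<^sup>\<sim> = the (x \<leadsto> \<zero>)"

definition pseudoinvolutive :: bool where
  "pseudoinvolutive \<longleftrightarrow>
     (\<forall>x\<in>R. \<forall>y\<in>R. x \<sqsubseteq> y \<longrightarrow> y\<^sup>- \<sqsubseteq> x\<^sup>- \<and> y\<^sup>\<sim> \<sqsubseteq> x\<^sup>\<sim>) \<and>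
     (\<forall>x\<in>R. (x\<^sup>-)\<^sup>\<sim> = x \<and> (x\<^sup>\<sim>)\<^sup>- = x)"

definition divisible :: bool where
  "divisible \<longleftrightarrow>
     (\<forall>x\<in>R. \<forall>y\<in>R. x \<sqsubseteq> y \<longleftrightarrow>
        Option.bind (y \<leadsto> x) (\<lambda>u. y \<odot> u) = Some x \<and>
        Option.bind (y \<rightarrow> x) (\<lambda>v. y \<star> v) = Some x)"

definition associative :: bool where
  "associative \<longleftrightarrow>
     (\<forall>x\<in>R. \<forall>y\<in>R. \<forall>z\<in>R.
        Option.bind (x \<odot> y) (\<lambda>u. u \<odot> z) = Option.bind (y \<odot> z) (\<lambda>v. x \<odot> v) \<and>
        Option.bind (x \<star> y) (\<lambda>u. u \<star> z) = Option.bind (y \<star> z) (\<lambda>v. x \<star> v))"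

definition pseudo_effect_condition :: bool where
  "pseudo_effect_condition \<longleftrightarrow>
     (\<forall>x\<in>R. \<forall>y\<in>R. x \<sqsubseteq> y\<^sup>- \<longrightarrow>
        (\<exists>u v. y\<^sup>- \<star> x\<^sup>- = Some u \<and> x\<^sup>\<sim> \<odot> y\<^sup>\<sim> = Some v \<and> u\<^sup>\<sim> = v\<^sup>-))"

end

end

theory Submission
  imports Defs
begin

text \<open>
  The residuated operations of the theorem are differences in disguise. As the two complements
  are mutually inverse, each of them says that a certain sum of two elements is the first
  argument:

    \<^item> \<open>x \<odot> y = u\<close> means \<open>y\<^sup>- \<oplus> u = x\<close>, and
      \<open>x \<star> y = u\<close> means \<open>u \<oplus> y\<^sup>\<sim> = x\<close>;

    \<^item> \<open>x \<rightarrow> y = v\<close> means \<open>y \<oplus> v\<^sup>\<sim> = x\<close>, and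
      \<open>x \<leadsto> y = v\<close> means \<open>v\<^sup>- \<oplus> y = x\<close>.

  In these terms (lemmas \<open>circ_eq_Some_iff\<close> and \<open>imp_eq_Some_iff\<close> with their mirror
  images) every condition becomes a fact about sums. Adjointness compares two decompositions
  \<open>x = y\<^sup>- \<oplus> u = v\<^sup>- \<oplus> z\<close> of one element, where by
  cancellation the right parts are ordered oppositely to the left parts. Divisibility reads the
  single equation \<open>u \<oplus> x = y\<close> in two ways. Associativity holds because
  \<open>y \<odot> z = v\<close> says \<open>v\<^sup>- = y\<^sup>- \<oplus> z\<^sup>-\<close>, so that both
  sides solve \<open>y\<^sup>- \<oplus> z\<^sup>- \<oplus> t = x\<close> for \<open>t\<close>. In the
  pseudo-effect algebra condition both sides equal \<open>x \<oplus> y\<close>.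

  Reversing the order of the summands turns a pseudo-effect algebra into another one, with the
  same order relation but with \<open>\<^sup>-\<close> and \<open>\<^sup>\<sim>\<close>, \<open>\<odot>\<close> and
  \<open>\<star>\<close>, \<open>\<rightarrow>\<close> and \<open>\<leadsto>\<close> interchanged. Hence only one of
  each pair of mirror statements needs an argument.
\<close>

context pseudo_effect_algebra
begin

section \<open>Reversing the order of the summands\<close>

lemma oplus_closed:
  assumes "a \<oplus> b = Some c"
  shows "a \<in> P" "b \<in> P" "c \<in> P"
  using assms partial_binop_oplus unfolding partial_binop_on_def by blast+

lemma opposite: "pseudo_effect_algebra P (\<lambda>a b. b \<oplus> a) \<zero> \<one>"
proof
  show "partial_binop_on P (\<lambda>a b. b \<oplus> a)"
    using oplus_closed unfolding partial_binop_on_def by blast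
  show "\<exists>d\<in>P. \<exists>e\<in>P. a \<oplus> d = Some c \<and> e \<oplus> b = Some c"
    if "a \<in> P" "b \<in> P" "b \<oplus> a = Some c" for a b c
    using PE3 that by blast
  show "Option.bind (b \<oplus> a) (\<lambda>u. c \<oplus> u) = Option.bind (c \<oplus> b) (\<lambda>v. v \<oplus> a)"
    if "a \<in> P" "b \<in> P" "c \<in> P" for a b c
    using PE1[OF that(3,2,1)] by (rule sym)
  show "a = \<zero>" if "a \<in> P" "\<one> \<oplus> a \<noteq> None \<or> a \<oplus> \<one> \<noteq> None" for a
    using PE4 that by blast
qed (rule zero_closed one_closed PE2_left PE2_right; assumption?)+

text \<open>
  Condition (PE3) turns a left summand into a right one, which makes the order symmetric under
  reversal.
\<close>

lemma le_iff_right_summand: "a \<sqsubseteq> b \<longleftrightarrow> (\<exists>c. a \<oplus> c = Some b)"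
  unfolding le_def using PE3 oplus_closed by meson

lemma le_iff_left_summand: "a \<sqsubseteq> b \<longleftrightarrow> (\<exists>c. c \<oplus> a = Some b)"
  unfolding le_def using oplus_closed by blast

lemma opposite_le: "pseudo_effect_algebra.le P (\<lambda>a b. b \<oplus> a) = (\<sqsubseteq>)"
  using le_iff_right_summand pseudo_effect_algebra.le_iff_left_summand[OF opposite]
  by (auto simp: fun_eq_iff)

lemma opposite_lcompl: "pseudo_effect_algebra.lcompl P (\<lambda>a b. b \<oplus> a) \<one> = rcompl"
  by (simp add: fun_eq_iff pseudo_effect_algebra.lcompl_def[OF opposite] rcompl_def
      pseudo_effect_algebra.ldiff_def[OF opposite] rdiff_def)

lemma opposite_rcompl: "pseudo_effect_algebra.rcompl P (\<lambda>a b. b \<oplus> a) \<one> = lcompl"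
  by (simp add: fun_eq_iff pseudo_effect_algebra.rcompl_def[OF opposite] lcompl_def
      pseudo_effect_algebra.rdiff_def[OF opposite] ldiff_def)

lemma opposite_circ: "pseudo_effect_algebra.circ P (\<lambda>a b. b \<oplus> a) \<one> = (\<star>)"
  by (simp add: fun_eq_iff pseudo_effect_algebra.circ_def[OF opposite] ast_def opposite_le
      opposite_lcompl pseudo_effect_algebra.rdiff_def[OF opposite] ldiff_def)

lemma opposite_ast: "pseudo_effect_algebra.ast P (\<lambda>a b. b \<oplus> a) \<one> = (\<odot>)"
  by (simp add: fun_eq_iff pseudo_effect_algebra.ast_def[OF opposite] circ_def opposite_le
      opposite_rcompl pseudo_effect_algebra.ldiff_def[OF opposite] rdiff_def)

lemma opposite_imp: "pseudo_effect_algebra.imp P (\<lambda>a b. b \<oplus> a) \<one> = (\<leadsto>)"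
  by (simp add: fun_eq_iff pseudo_effect_algebra.imp_def[OF opposite] limp_def opposite_le
      opposite_lcompl opposite_rcompl opposite_circ)

lemma opposite_limp: "pseudo_effect_algebra.limp P (\<lambda>a b. b \<oplus> a) \<one> = (\<rightarrow>)"
  by (simp add: fun_eq_iff pseudo_effect_algebra.limp_def[OF opposite] imp_def opposite_le
      opposite_lcompl opposite_rcompl opposite_ast)

lemmas opposite_simps = opposite_le opposite_lcompl opposite_rcompl opposite_circ opposite_ast
  opposite_imp opposite_limp


section \<open>Sums, complements and the order\<close>

lemma oplus_assoc_rightD:
  assumes "a \<oplus> b = Some u" "u \<oplus> c = Some w"
  obtains v where "b \<oplus> c = Some v" "a \<oplus> v = Some w"
proof -
  have "Option.bind (b \<oplus> c) (\<lambda>v. a \<oplus> v) = Some w"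
    using PE1[of a b c] assms oplus_closed[OF assms(1)] oplus_closed[OF assms(2)] by simp
  then show thesis using that by (auto simp: bind_eq_Some_conv)
qed

lemma oplus_assoc_leftD:
  assumes "b \<oplus> c = Some v" "a \<oplus> v = Some w"
  obtains u where "a \<oplus> b = Some u" "u \<oplus> c = Some w"
  using pseudo_effect_algebra.oplus_assoc_rightD[OF opposite] assms by blast

lemma lcompl_eq_iff: "a \<in> P \<Longrightarrow> a\<^sup>- = b \<longleftrightarrow> b \<oplus> a = Some \<one>"
proof -
  assume "a \<in> P"
  then have ex1: "\<exists>!e. e \<in> P \<and> e \<oplus> a = Some \<one>" by (rule PE2_left)
  from theI'[OF this] show ?thesis
    unfolding lcompl_def ldiff_def using ex1 oplus_closed by blast
qed

lemma rcompl_eq_iff: "a \<in> P \<Longrightarrow> a\<^sup>\<sim> = b \<longleftrightarrow> a \<oplus> b = Some \<one>"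
  using pseudo_effect_algebra.lcompl_eq_iff[OF opposite] by (simp add: opposite_simps)

lemma lcompl_oplus: "a \<in> P \<Longrightarrow> a\<^sup>- \<oplus> a = Some \<one>"
  using lcompl_eq_iff by blast

lemma oplus_rcompl: "a \<in> P \<Longrightarrow> a \<oplus> a\<^sup>\<sim> = Some \<one>"
  using rcompl_eq_iff by blast

lemma lcompl_closed [simp]: "a \<in> P \<Longrightarrow> a\<^sup>- \<in> P"
  using lcompl_oplus oplus_closed by blast

lemma rcompl_closed [simp]: "a \<in> P \<Longrightarrow> a\<^sup>\<sim> \<in> P"
  using oplus_rcompl oplus_closed by blast

lemma rcompl_lcompl [simp]: "a \<in> P \<Longrightarrow> (a\<^sup>-)\<^sup>\<sim> = a"
  using rcompl_eq_iff lcompl_oplus by simp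

lemma lcompl_rcompl [simp]: "a \<in> P \<Longrightarrow> (a\<^sup>\<sim>)\<^sup>- = a"
  using lcompl_eq_iff oplus_rcompl by simp

lemma one_oplus_zero: "\<one> \<oplus> \<zero> = Some \<one>"
  using oplus_rcompl[OF one_closed] PE4[of "\<one>\<^sup>\<sim>"] one_closed by auto

text \<open>
  By (PE4) the right complement of \<open>\<one>\<close> is \<open>\<zero>\<close>. Appending \<open>\<zero>\<close> to
  \<open>a\<^sup>- \<oplus> a = \<one>\<close> therefore shows that \<open>a \<oplus> \<zero>\<close> is another
  right complement of \<open>a\<^sup>-\<close>.
\<close>

lemma oplus_zero: "a \<in> P \<Longrightarrow> a \<oplus> \<zero> = Some a"
proof -
  assume a: "a \<in> P"
  obtain v where v: "a \<oplus> \<zero> = Some v" "a\<^sup>- \<oplus> v = Some \<one>"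
    using oplus_assoc_rightD[OF lcompl_oplus[OF a] one_oplus_zero] .
  then have "v = a" using rcompl_eq_iff[of "a\<^sup>-" v] a by simp
  with v show ?thesis by simp
qed

lemma zero_oplus: "a \<in> P \<Longrightarrow> \<zero> \<oplus> a = Some a"
  using pseudo_effect_algebra.oplus_zero[OF opposite] .

lemma lcompl_one [simp]: "\<one>\<^sup>- = \<zero>"
  and rcompl_zero [simp]: "\<zero>\<^sup>\<sim> = \<one>"
  using lcompl_eq_iff rcompl_eq_iff zero_oplus one_closed zero_closed by blast+

text \<open>
  Prefixing the left complement of the common sum makes both remaining summands right complements
  of one element.
\<close>

lemma oplus_left_cancel:
  assumes "a \<oplus> b = Some s" "a \<oplus> c = Some s"
  shows "b = c"
proof -
  have s: "s\<^sup>- \<oplus> s = Some \<one>" using assms oplus_closed lcompl_oplus by blast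
  obtain u where "s\<^sup>- \<oplus> a = Some u" "u \<oplus> b = Some \<one>"
    using oplus_assoc_leftD[OF assms(1) s] .
  moreover obtain u' where "s\<^sup>- \<oplus> a = Some u'" "u' \<oplus> c = Some \<one>"
    using oplus_assoc_leftD[OF assms(2) s] .
  ultimately show ?thesis using rcompl_eq_iff oplus_closed by (metis option.inject)
qed

lemma oplus_right_cancel: "b \<oplus> a = Some s \<Longrightarrow> c \<oplus> a = Some s \<Longrightarrow> b = c"
  using pseudo_effect_algebra.oplus_left_cancel[OF opposite] .

lemma rdiff_eqI:
  assumes "a \<oplus> b = Some s"
  shows "rdiff a s = b"
  unfolding rdiff_def using assms oplus_closed oplus_left_cancel by blast

text \<open>
  Reassociating \<open>b\<^sup>- \<oplus> (c \<oplus> a) = \<one>\<close> exhibits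
  \<open>b\<^sup>- \<oplus> c\<close> as a left complement of \<open>a\<close>. This rule makes the complements
  antitone, and it also describes \<open>\<odot>\<close> below.
\<close>

lemma lcompl_oplus_assoc:
  assumes "c \<oplus> a = Some b"
  shows "b\<^sup>- \<oplus> c = Some (a\<^sup>-)"
  using oplus_assoc_leftD[OF assms lcompl_oplus] oplus_closed[OF assms] lcompl_eq_iff by metis

lemma le_imp_lcompl_le: "a \<sqsubseteq> b \<Longrightarrow> b\<^sup>- \<sqsubseteq> a\<^sup>-"
  using le_iff_left_summand le_iff_right_summand lcompl_oplus_assoc by blast

lemma le_imp_rcompl_le: "a \<sqsubseteq> b \<Longrightarrow> b\<^sup>\<sim> \<sqsubseteq> a\<^sup>\<sim>"
  using pseudo_effect_algebra.le_imp_lcompl_le[OF opposite] by (simp add: opposite_simps)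

lemma lcompl_le_lcompl_iff: "a \<in> P \<Longrightarrow> b \<in> P \<Longrightarrow> b\<^sup>- \<sqsubseteq> a\<^sup>- \<longleftrightarrow> a \<sqsubseteq> b"
  using le_imp_lcompl_le le_imp_rcompl_le[of "b\<^sup>-" "a\<^sup>-"] by auto

text \<open>
  If \<open>a \<oplus> b = \<zero>\<close>, then \<open>\<one> \<oplus> (a \<oplus> b)\<close> exists, hence so does
  \<open>\<one> \<oplus> a\<close>, which (PE4) allows only for \<open>a = \<zero>\<close>.
\<close>

lemma oplus_eq_zeroD:
  assumes "a \<oplus> b = Some \<zero>"
  shows "a = \<zero>"
  using oplus_assoc_leftD[OF assms one_oplus_zero] PE4 oplus_closed[OF assms]
  by (metis option.distinct(1))

lemma le_refl: "a \<in> P \<Longrightarrow> a \<sqsubseteq> a"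
  using zero_oplus le_iff_left_summand by blast

lemma le_trans:
  assumes "a \<sqsubseteq> b" "b \<sqsubseteq> c"
  shows "a \<sqsubseteq> c"
  using assms oplus_assoc_leftD unfolding le_iff_left_summand by metis

lemma le_antisym:
  assumes "a \<sqsubseteq> b" "b \<sqsubseteq> a"
  shows "a = b"
proof -
  obtain c d where cd: "c \<oplus> a = Some b" "d \<oplus> b = Some a"
    using assms le_iff_left_summand by blast
  have a: "\<zero> \<oplus> a = Some a" using zero_oplus cd oplus_closed by blast
  \<comment> \<open>Here \<open>a = (d \<oplus> c) \<oplus> a\<close>, and \<open>a\<close> cancels.\<close>
  have "d \<oplus> c = Some \<zero>"
    using oplus_assoc_leftD[OF cd] oplus_right_cancel[OF a] by metis
  then have "d = \<zero>" by (rule oplus_eq_zeroD)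
  then show ?thesis using cd zero_oplus oplus_closed by (metis option.inject)
qed

text \<open>
  If \<open>d = e \<oplus> b\<close>, then \<open>a \<oplus> b = c \<oplus> e \<oplus> b\<close>, and cancelling
  \<open>b\<close> leaves \<open>a = c \<oplus> e\<close>; conversely, cancel \<open>c\<close> instead.
\<close>

lemma equal_sums_le_iff:
  assumes "a \<oplus> b = Some s" "c \<oplus> d = Some s"
  shows "b \<sqsubseteq> d \<longleftrightarrow> c \<sqsubseteq> a"
proof
  assume "b \<sqsubseteq> d"
  then obtain e where "e \<oplus> b = Some d" using le_iff_left_summand by blast
  from oplus_assoc_leftD[OF this assms(2)] show "c \<sqsubseteq> a"
    using oplus_right_cancel[OF assms(1)] le_iff_right_summand by metis
next
  assume "c \<sqsubseteq> a"
  then obtain e where "c \<oplus> e = Some a" using le_iff_right_summand by blast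
  from oplus_assoc_rightD[OF this assms(1)] show "b \<sqsubseteq> d"
    using oplus_left_cancel[OF assms(2)] le_iff_left_summand by metis
qed


section \<open>The residuated operations as equations between sums\<close>

lemma circ_eq_Some_iff: "x \<odot> y = Some u \<longleftrightarrow> y \<in> P \<and> y\<^sup>- \<oplus> u = Some x"
  unfolding circ_def le_iff_right_summand using rdiff_eqI oplus_closed
  by (auto split: if_splits)

lemma ast_eq_Some_iff: "x \<star> y = Some u \<longleftrightarrow> y \<in> P \<and> u \<oplus> y\<^sup>\<sim> = Some x"
  using pseudo_effect_algebra.circ_eq_Some_iff[OF opposite] by (simp add: opposite_simps)

lemma imp_eq_Some_iff: "x \<rightarrow> y = Some v \<longleftrightarrow> y \<in> P \<and> v \<in> P \<and> y \<oplus> v\<^sup>\<sim> = Some x"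
proof
  assume "x \<rightarrow> y = Some v"
  then show "y \<in> P \<and> v \<in> P \<and> y \<oplus> v\<^sup>\<sim> = Some x"
    unfolding imp_def using oplus_closed by (auto split: if_splits simp: circ_eq_Some_iff)
next
  assume v: "y \<in> P \<and> v \<in> P \<and> y \<oplus> v\<^sup>\<sim> = Some x"
  then have "y \<sqsubseteq> x" "x \<odot> y\<^sup>\<sim> = Some (v\<^sup>\<sim>)"
    by (auto simp: circ_eq_Some_iff le_iff_right_summand)
  then show "x \<rightarrow> y = Some v" using v oplus_closed by (auto simp: imp_def)
qed

lemma limp_eq_Some_iff: "x \<leadsto> y = Some v \<longleftrightarrow> y \<in> P \<and> v \<in> P \<and> v\<^sup>- \<oplus> y = Some x"
  using pseudo_effect_algebra.imp_eq_Some_iff[OF opposite] by (simp add: opposite_simps)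

lemma partial_binop_circ: "partial_binop_on P (\<odot>)"
  unfolding partial_binop_on_def circ_eq_Some_iff using oplus_closed by blast

lemma partial_binop_imp: "partial_binop_on P (\<rightarrow>)"
  unfolding partial_binop_on_def imp_eq_Some_iff using oplus_closed by blast

lemma imp_zero: "x \<in> P \<Longrightarrow> x \<rightarrow> \<zero> = Some (x\<^sup>-)"
  by (simp add: imp_eq_Some_iff zero_closed zero_oplus)

lemma limp_zero: "x \<in> P \<Longrightarrow> x \<leadsto> \<zero> = Some (x\<^sup>\<sim>)"
  by (simp add: limp_eq_Some_iff zero_closed oplus_zero)

lemma imp_defined_iff: "x \<rightarrow> y \<noteq> None \<longleftrightarrow> y \<sqsubseteq> x"
proof
  assume "y \<sqsubseteq> x"
  then obtain c where c: "y \<oplus> c = Some x" using le_iff_right_summand by blast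
  then have "x \<rightarrow> y = Some (c\<^sup>-)" using oplus_closed[OF c] by (simp add: imp_eq_Some_iff)
  then show "x \<rightarrow> y \<noteq> None" by simp
qed (auto simp: imp_eq_Some_iff le_iff_right_summand)

lemma circ_defined_iff: "x \<in> P \<Longrightarrow> y \<in> P \<Longrightarrow> x \<odot> y \<noteq> None \<longleftrightarrow> y\<^sup>- \<sqsubseteq> x"
  by (simp add: circ_def)

lemma circ_one: "x \<in> P \<Longrightarrow> x \<odot> \<one> = Some x"
  by (simp add: circ_eq_Some_iff one_closed zero_oplus)

lemma one_circ: "x \<in> P \<Longrightarrow> \<one> \<odot> x = Some x"
  by (simp add: circ_eq_Some_iff lcompl_oplus)

lemma circ_limp_adjoint:
  assumes "x \<odot> y = Some u" "x \<leadsto> z = Some v"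
  shows "u \<sqsubseteq> z \<longleftrightarrow> y \<sqsubseteq> v"
  using assms equal_sums_le_iff[of "y\<^sup>-" u x "v\<^sup>-" z] lcompl_le_lcompl_iff[of y v]
  by (simp add: circ_eq_Some_iff limp_eq_Some_iff)

text \<open>
  The equation \<open>v\<^sup>- \<oplus> x = y\<close> says both that \<open>y \<leadsto> x = v\<close> and that
  \<open>y \<odot> v = x\<close>.
\<close>

lemma limp_eq_Some_iff_circ: "x \<in> P \<Longrightarrow> y \<leadsto> x = Some v \<longleftrightarrow> y \<odot> v = Some x"
  by (auto simp: limp_eq_Some_iff circ_eq_Some_iff)

lemma limp_defined_iff: "x \<leadsto> y \<noteq> None \<longleftrightarrow> y \<sqsubseteq> x"
  using pseudo_effect_algebra.imp_defined_iff[OF opposite] by (simp add: opposite_simps)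

lemma circ_limp_divisible:
  assumes "x \<in> P"
  shows "Option.bind (y \<leadsto> x) (\<lambda>v. y \<odot> v) = Some x \<longleftrightarrow> x \<sqsubseteq> y"
  using limp_eq_Some_iff_circ[OF assms] limp_defined_iff[of y x]
  by (auto simp: bind_eq_Some_conv)

text \<open>
  De Morgan duality: \<open>\<odot>\<close> is \<open>\<oplus>\<close> transported along the complement, since
  \<open>y\<^sup>- \<oplus> v = x\<close> and \<open>x\<^sup>- \<oplus> y\<^sup>- = v\<^sup>-\<close> both express
  \<open>x\<^sup>- \<oplus> y\<^sup>- \<oplus> v = \<one>\<close>.
\<close>

lemma circ_eq_Some_iff_lcompl:
  assumes "x \<in> P" "y \<in> P"
  shows "x \<odot> y = Some v \<longleftrightarrow> v \<in> P \<and> x\<^sup>- \<oplus> y\<^sup>- = Some (v\<^sup>-)"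
proof
  assume "x \<odot> y = Some v"
  then have v: "y\<^sup>- \<oplus> v = Some x" by (simp add: circ_eq_Some_iff)
  from lcompl_oplus_assoc[OF this] show "v \<in> P \<and> x\<^sup>- \<oplus> y\<^sup>- = Some (v\<^sup>-)"
    using oplus_closed[OF v] by simp
next
  assume v: "v \<in> P \<and> x\<^sup>- \<oplus> y\<^sup>- = Some (v\<^sup>-)"
  then obtain w where w: "y\<^sup>- \<oplus> v = Some w" "x\<^sup>- \<oplus> w = Some \<one>"
    using oplus_assoc_rightD lcompl_oplus by blast
  then have "w = x" using rcompl_eq_iff[of "x\<^sup>-" w] assms by simp
  with w show "x \<odot> y = Some v" using assms by (simp add: circ_eq_Some_iff)
qed

text \<open>
  Both sides have the value \<open>t\<close> exactly when
  \<open>y\<^sup>- \<oplus> z\<^sup>- \<oplus> t = x\<close>; the two bracketings correspond to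
  \<open>x \<odot> y = z\<^sup>- \<oplus> t\<close> and \<open>(y \<odot> z)\<^sup>- = y\<^sup>- \<oplus> z\<^sup>-\<close>.
\<close>

lemma circ_assoc:
  assumes "x \<in> P" "y \<in> P" "z \<in> P"
  shows "Option.bind (x \<odot> y) (\<lambda>u. u \<odot> z) = Option.bind (y \<odot> z) (\<lambda>v. x \<odot> v)"
proof -
  have "(Option.bind (x \<odot> y) (\<lambda>u. u \<odot> z) = Some t) =
      (Option.bind (y \<odot> z) (\<lambda>v. x \<odot> v) = Some t)" for t
  proof
    assume "Option.bind (x \<odot> y) (\<lambda>u. u \<odot> z) = Some t"
    then obtain u where u: "y\<^sup>- \<oplus> u = Some x" "z\<^sup>- \<oplus> t = Some u"
      by (auto simp: bind_eq_Some_conv circ_eq_Some_iff)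
    obtain w where w: "y\<^sup>- \<oplus> z\<^sup>- = Some w" "w \<oplus> t = Some x"
      using oplus_assoc_leftD[OF u(2,1)] .
    have "y \<odot> z = Some (w\<^sup>\<sim>)" "x \<odot> w\<^sup>\<sim> = Some t"
      using w oplus_closed[OF w(1)] assms
      by (simp_all add: circ_eq_Some_iff_lcompl[of y z] circ_eq_Some_iff[of x])
    then show "Option.bind (y \<odot> z) (\<lambda>v. x \<odot> v) = Some t" by simp
  next
    assume "Option.bind (y \<odot> z) (\<lambda>v. x \<odot> v) = Some t"
    then obtain v where v: "y\<^sup>- \<oplus> z\<^sup>- = Some (v\<^sup>-)" "v\<^sup>- \<oplus> t = Some x"
      using assms by (auto simp: bind_eq_Some_conv circ_eq_Some_iff_lcompl[of y z]
          circ_eq_Some_iff[of x])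
    obtain u where "z\<^sup>- \<oplus> t = Some u" "y\<^sup>- \<oplus> u = Some x"
      using oplus_assoc_rightD[OF v] .
    then have "x \<odot> y = Some u" "u \<odot> z = Some t"
      using assms by (simp_all add: circ_eq_Some_iff)
    then show "Option.bind (x \<odot> y) (\<lambda>u. u \<odot> z) = Some t" by simp
  qed
  then show ?thesis by (metis option.exhaust)
qed

text \<open>
  The assumption means that the sum \<open>s = x \<oplus> y\<close> exists. Completing it to \<open>\<one>\<close>
  on the left gives \<open>s\<^sup>- \<oplus> x = y\<^sup>-\<close>, and on the right
  \<open>y \<oplus> s\<^sup>\<sim> = x\<^sup>\<sim>\<close>.
\<close>

lemma ast_lcompl_circ_rcompl:
  assumes "x \<in> P" "y \<in> P" "x \<sqsubseteq> y\<^sup>-"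
  obtains s where "y\<^sup>- \<star> x\<^sup>- = Some (s\<^sup>-)" "x\<^sup>\<sim> \<odot> y\<^sup>\<sim> = Some (s\<^sup>\<sim>)" "s \<in> P"
proof -
  obtain u where "u \<oplus> x = Some (y\<^sup>-)" using assms le_iff_left_summand by blast
  then obtain s where s: "x \<oplus> y = Some s"
    using oplus_assoc_rightD lcompl_oplus[OF assms(2)] by blast
  have "s\<^sup>- \<oplus> x = Some (y\<^sup>-)" by (rule lcompl_oplus_assoc[OF s])
  moreover have "y \<oplus> s\<^sup>\<sim> = Some (x\<^sup>\<sim>)"
    using pseudo_effect_algebra.lcompl_oplus_assoc[OF opposite s] by (simp add: opposite_simps)
  ultimately show thesis
    using that[of s] assms oplus_closed[OF s] by (simp add: ast_eq_Some_iff circ_eq_Some_iff)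
qed


section \<open>The conditional double CI-poset of a pseudo-effect algebra\<close>

sublocale CI: conditional_double_CI_poset P "(\<sqsubseteq>)" "(\<odot>)" "(\<star>)" "(\<rightarrow>)" "(\<leadsto>)" \<zero> \<one>
proof
  show "reflp_on P (\<sqsubseteq>)" "antisymp_on P (\<sqsubseteq>)" "transp_on P (\<sqsubseteq>)"
    using le_refl le_antisym le_trans
    by (auto intro: reflp_onI antisymp_onI transp_onI)
  show "\<zero> \<sqsubseteq> x" if "x \<in> P" for x
    using oplus_zero[OF that] le_iff_left_summand by blast
  show "x \<sqsubseteq> \<one>" if "x \<in> P" for x
    using lcompl_oplus[OF that] le_iff_left_summand by blast
  show "partial_binop_on P (\<star>)"
    using pseudo_effect_algebra.partial_binop_circ[OF opposite] by (simp add: opposite_simps)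
  show "partial_binop_on P (\<leadsto>)"
    using pseudo_effect_algebra.partial_binop_imp[OF opposite] by (simp add: opposite_simps)
  show "x \<odot> y \<noteq> None \<longleftrightarrow> the (y \<rightarrow> \<zero>) \<sqsubseteq> x" if "x \<in> P" "y \<in> P" for x y
    using circ_defined_iff[OF that] imp_zero[OF that(2)] by simp
  show "x \<star> y \<noteq> None \<longleftrightarrow> the (y \<leadsto> \<zero>) \<sqsubseteq> x" if "x \<in> P" "y \<in> P" for x y
    using pseudo_effect_algebra.circ_defined_iff[OF opposite that] limp_zero[OF that(2)]
    by (simp add: opposite_simps)
  show "x \<star> \<one> = Some x" "\<one> \<star> x = Some x" if "x \<in> P" for x
    using pseudo_effect_algebra.circ_one[OF opposite that]
      pseudo_effect_algebra.one_circ[OF opposite that] by (simp_all add: opposite_simps)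
  show "u \<sqsubseteq> z \<longleftrightarrow> y \<sqsubseteq> v" if "x \<star> y = Some u" "x \<rightarrow> z = Some v" for x y z u v
    using pseudo_effect_algebra.circ_limp_adjoint[OF opposite] that
    by (simp add: opposite_simps)
qed (use zero_closed one_closed partial_binop_circ partial_binop_imp imp_defined_iff
    limp_defined_iff circ_one one_circ circ_limp_adjoint in auto)

lemma CI_lneg: "x \<in> P \<Longrightarrow> CI.lneg x = x\<^sup>-"
  and CI_rneg: "x \<in> P \<Longrightarrow> CI.rneg x = x\<^sup>\<sim>"
  by (simp_all add: CI.lneg_def CI.rneg_def imp_zero limp_zero)

lemma CI_pseudoinvolutive: "CI.pseudoinvolutive"
  unfolding CI.pseudoinvolutive_def
  by (simp add: CI_lneg CI_rneg le_imp_lcompl_le le_imp_rcompl_le)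

lemma CI_divisible: "CI.divisible"
proof -
  have "Option.bind (y \<rightarrow> x) (\<lambda>v. y \<star> v) = Some x \<longleftrightarrow> x \<sqsubseteq> y" if "x \<in> P" for x y
    using pseudo_effect_algebra.circ_limp_divisible[OF opposite that]
    by (simp add: opposite_simps)
  then show ?thesis unfolding CI.divisible_def using circ_limp_divisible by simp
qed

lemma CI_associative: "CI.associative"
proof -
  have "Option.bind (x \<star> y) (\<lambda>u. u \<star> z) = Option.bind (y \<star> z) (\<lambda>v. x \<star> v)"
    if "x \<in> P" "y \<in> P" "z \<in> P" for x y z
    using pseudo_effect_algebra.circ_assoc[OF opposite that] by (simp add: opposite_simps)
  then show ?thesis unfolding CI.associative_def using circ_assoc by blast
qed

lemma CI_pseudo_effect_condition: "CI.pseudo_effect_condition"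
  unfolding CI.pseudo_effect_condition_def
proof (intro ballI impI)
  fix x y
  assume xy: "x \<in> P" "y \<in> P" and "x \<sqsubseteq> CI.lneg y"
  then have "x \<sqsubseteq> y\<^sup>-" by (simp add: CI_lneg)
  then obtain s where "y\<^sup>- \<star> x\<^sup>- = Some (s\<^sup>-)" "x\<^sup>\<sim> \<odot> y\<^sup>\<sim> = Some (s\<^sup>\<sim>)" "s \<in> P"
    using ast_lcompl_circ_rcompl xy by blast
  then show "\<exists>u v. CI.lneg y \<star> CI.lneg x = Some u \<and> CI.rneg x \<odot> CI.rneg y = Some v \<and>
      CI.rneg u = CI.lneg v"
    using xy by (simp add: CI_lneg CI_rneg)
qed

end


theorem theorem5p3:
  fixes P :: "'a set"
    and oplus :: "'a \<Rightarrow> 'a \<Rightarrow> 'a option"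
    and zero one :: 'a
  assumes "pseudo_effect_algebra P oplus zero one"
  shows "let le = pseudo_effect_algebra.le P oplus;
             circ = pseudo_effect_algebra.circ P oplus one;
             ast = pseudo_effect_algebra.ast P oplus one;
             imp = pseudo_effect_algebra.imp P oplus one;
             limp = pseudo_effect_algebra.limp P oplus one
         in conditional_double_CI_poset P le circ ast imp limp zero one \<and>
            conditional_double_CI_poset.pseudoinvolutive P le imp limp zero \<and>
            conditional_double_CI_poset.divisible P le circ ast imp limp \<and>
            conditional_double_CI_poset.associative P circ ast \<and>
            conditional_double_CI_poset.pseudo_effect_condition P le circ ast imp limp zero"
proof -
  interpret pseudo_effect_algebra P oplus zero one by fact
  show ?thesis
    using CI.conditional_double_CI_poset_axioms CI_pseudoinvolutive CI_divisible CI_associative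
      CI_pseudo_effect_condition
    by (simp add: Let_def)
qed

end
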